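(* Let $a,b\in\mathbb N$ (with $0\in\mathbb N$). (1) Let $\alpha=(\alpha_0,\dots,\alpha_a)\in\mathbb N^{a+1}$ and $\beta=(\beta_0,\dots,\beta_b)\in\mathbb N^{b+1}$ be such that $b=\sum_{i=0}^a\alpha_i$ and $a=\sum_{i=0}^b\beta_i$. Then the number of labelled bipartite trees with vertex bipartition $\mathcal U\cup\mathcal V$, where the vertices $\mathcal U=\{u_0,\dots,u_a\}$ have degrees $\deg(u_i)=1+\alpha_i$ and the vertices $\mathcal V=\{v_0,\dots,v_b\}$ have degrees $\deg(v_i)=1+\beta_i$, is $$\binom{a}{\beta}\binom{b}{\alpha}=\frac{a!\,b!}{\left(\prod_{i=0}^b\beta_i!\right)\left(\prod_{i=0}^a\alpha_i!\right)}.$$ (2) Equivalently, with $x_0,\dots,x_a,y_0,\dots,y_b$ commuting indeterminates, $$\sum_{T\in\mathcal T(a+1,b+1)}\left(\prod_{i=0}^a x_i^{\deg(u_i)-1}\right)\left(\prod_{i=0}^b y_i^{\deg(v_i)-1}\right)=\left(x_0+\dots+x_a\right)^b\left(y_0+\dots+y_b\right)^a,$$ where $\mathcal T(a+1,b+1)$ is the set of all labelled bipartite trees with $a+1$ vertices $u_0,\dots,u_a$ in the first class and $b+1$ vertices $v_0,\dots,v_b$ in the second class of the vertex bipartition, and degrees are taken in $T$.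
   Context: A labelled bipartite tree with vertex bipartition $\mathcal U\cup\mathcal V$ ($\mathcal U$ and $\mathcal V$ disjoint) is an ordinary tree (connected acyclic simple graph) on the vertex set $\mathcal U\cup\mathcal V$ in which no two adjacent vertices belong to the same class, i.e. every edge joins an element of $\mathcal U$ to an element of $\mathcal V$. The classes and all vertices are labelled, so two such trees are the same only if their edge sets are equal. Multinomial coefficients: $\binom{a}{\beta}=\frac{a!}{\prod_{i=0}^b\beta_i!}$ and $\binom{b}{\alpha}=\frac{b!}{\prod_{i=0}^a\alpha_i!}$. *)

theory Defs
  imports Complex_Main "HOL-Library.Poly_Mapping"
begin

text \<open>A simple graph is given by a vertex set \<open>V\<close> and a set \<open>E\<close> of two-element subsets of \<open>V\<close>.\<close>

definition simple_graph :: "'v set \<Rightarrow> 'v set set \<Rightarrow> bool" where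
  "simple_graph V E \<longleftrightarrow> (\<forall>e\<in>E. e \<subseteq> V \<and> card e = 2)"

definition graph_connected :: "'v set \<Rightarrow> 'v set set \<Rightarrow> bool" where
  "graph_connected V E \<longleftrightarrow> V \<noteq> {} \<and> (\<forall>x\<in>V. \<forall>y\<in>V. (x, y) \<in> {(s, t). {s, t} \<in> E}\<^sup>*)"

text \<open>A cycle is listed by its (at least three, pairwise distinct) vertices; the edge from the last
  vertex back to the first one is the case \<open>i = length c - 1\<close>.\<close>

definition graph_cycle :: "'v set set \<Rightarrow> 'v list \<Rightarrow> bool" where
  "graph_cycle E c \<longleftrightarrow> 3 \<le> length c \<and> distinct c \<and>
     (\<forall>i<length c. {c ! i, c ! (Suc i mod length c)} \<in> E)"

definition graph_tree :: "'v set \<Rightarrow> 'v set set \<Rightarrow> bool" where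
  "graph_tree V E \<longleftrightarrow> simple_graph V E \<and> graph_connected V E \<and> \<not> (\<exists>c. graph_cycle E c)"

definition graph_degree :: "'v set set \<Rightarrow> 'v \<Rightarrow> nat" where
  "graph_degree E x = card {e \<in> E. x \<in> e}"

text \<open>Labelled bipartite trees on \<open>U \<union> V\<close> (meant for disjoint \<open>U\<close> and \<open>V\<close>), identified with their
  edge sets.\<close>

definition bipartite_trees :: "'v set \<Rightarrow> 'v set \<Rightarrow> 'v set set set" where
  "bipartite_trees U V =
     {E. graph_tree (U \<union> V) E \<and> (\<forall>e\<in>E. \<exists>u\<in>U. \<exists>v\<in>V. e = {u, v})}"

text \<open>The vertex \<open>u\<^sub>i\<close> is \<open>Inl i\<close> and the vertex \<open>v\<^sub>i\<close> is \<open>Inr i\<close>.\<close>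

definition labelled_bipartite_trees :: "nat \<Rightarrow> nat \<Rightarrow> (nat + nat) set set set" where
  "labelled_bipartite_trees m n = bipartite_trees (Inl ` {..<m}) (Inr ` {..<n})"

definition multinomial :: "nat \<Rightarrow> 'i set \<Rightarrow> ('i \<Rightarrow> nat) \<Rightarrow> rat" where
  "multinomial n I k = fact n / (\<Prod>i\<in>I. fact (k i))"

text \<open>Polynomials with integer coefficients in commuting indeterminates indexed by \<open>'v\<close>: finitely
  supported maps from monomials (finitely supported exponent vectors) to coefficients, with the
  convolution product of \<open>Poly_Mapping\<close>.\<close>

type_synonym 'v int_mpoly = "('v \<Rightarrow>\<^sub>0 nat) \<Rightarrow>\<^sub>0 int"

definition indet :: "'v \<Rightarrow> 'v int_mpoly" where
  "indet v = Poly_Mapping.single (Poly_Mapping.single v 1) 1"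

text \<open>The indeterminates \<open>x\<^sub>i\<close> and \<open>y\<^sub>i\<close> are indexed by the vertices \<open>u\<^sub>i\<close> and \<open>v\<^sub>i\<close>.\<close>

abbreviation x_indet :: "nat \<Rightarrow> (nat + nat) int_mpoly" where
  "x_indet i \<equiv> indet (Inl i)"

abbreviation y_indet :: "nat \<Rightarrow> (nat + nat) int_mpoly" where
  "y_indet i \<equiv> indet (Inr i)"

end

theory Submission
  imports Defs
begin

text \<open>
  Write \<open>Suc (d x)\<close> for the prescribed degree of the vertex \<open>x\<close>, so that the excess degrees \<open>d\<close> sum to
  \<open>card V - 1\<close> over \<open>U\<close> and to \<open>card U - 1\<close> over \<open>V\<close>. On the larger side the sum is less than the number
  of vertices, so this side has a vertex \<open>v\<close> with \<open>d v = 0\<close>, a leaf of every tree to be counted.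
  Classifying the trees by the neighbour \<open>u\<close> of \<open>v\<close> and deleting \<open>v\<close> leaves the trees on a smaller
  bipartition in which the excess degree of \<open>u\<close> has dropped by one
  (\<open>card_trees_with_degrees_remove_leaf\<close>). The product of the two multinomial coefficients satisfies the
  same recurrence: one factor does not change, since \<open>0! = 1\<close>, and the other follows the generalised
  Pascal rule \<open>multinom_rec\<close>. Induction gives the count (\<open>card_trees_with_degrees\<close>).

  For the generating function, the trees are grouped by their degrees and the multinomial theorem is
  applied to both powers on the right. What remains to be seen is that no tree falls outside these
  groups, that is, the excess degrees of every bipartite tree have the sums above. Every edge has
  exactly one end in \<open>U\<close>, so this amounts to the fact that a tree has one edge less than vertices
  (\<open>card_edges_graph_tree\<close>), which again follows by deleting leaves.
\<close>

section \<open>Multinomial coefficients\<close>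

text \<open>The values are natural numbers, rather than rational ones as for \<open>multinomial\<close>, because they
  count trees and become coefficients in an arbitrary semiring.\<close>

definition multinom :: "'i set \<Rightarrow> ('i \<Rightarrow> nat) \<Rightarrow> nat" where
  "multinom A k = fact (\<Sum>i\<in>A. k i) div (\<Prod>i\<in>A. fact (k i))"

lemma prod_fact_dvd_fact_sum:
  "finite A \<Longrightarrow> (\<Prod>i\<in>A. fact (k i)) dvd (fact (\<Sum>i\<in>A. k i) :: nat)"
proof (induction A rule: finite_induct)
  case (insert a A)
  have "fact (k a) * (\<Prod>i\<in>A. fact (k i)) dvd fact (k a) * (fact (\<Sum>i\<in>A. k i) :: nat)"
    using insert by (intro mult_dvd_mono) auto
  also have "\<dots> dvd fact (k a + (\<Sum>i\<in>A. k i))"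
    by (rule fact_fact_dvd_fact)
  finally show ?case
    using insert by simp
qed simp

lemma multinom_mult_prod_fact:
  "finite A \<Longrightarrow> multinom A k * (\<Prod>i\<in>A. fact (k i)) = fact (\<Sum>i\<in>A. k i)"
  unfolding multinom_def by (rule dvd_div_mult_self[OF prod_fact_dvd_fact_sum])

lemma of_nat_multinom:
  "finite A \<Longrightarrow> of_nat (multinom A k) = multinomial (\<Sum>i\<in>A. k i) A k"
  using arg_cong[OF multinom_mult_prod_fact[of A k], of "of_nat :: nat \<Rightarrow> rat"]
  by (simp add: multinomial_def eq_divide_eq)

lemma multinom_cong:
  "A = B \<Longrightarrow> (\<And>i. i \<in> B \<Longrightarrow> k i = l i) \<Longrightarrow> multinom A k = multinom B l"
  unfolding multinom_def by (simp cong: sum.cong prod.cong)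

lemma multinom_remove_0:
  assumes "finite A" "k a = 0"
  shows "multinom (A - {a}) k = multinom A k"
  using assms unfolding multinom_def
  by (cases "a \<in> A") (simp_all add: sum.remove[of A a] prod.remove[of A a] Diff_insert0[of a A "{}"])

lemma sum_decrease:
  fixes k :: "'i \<Rightarrow> nat"
  assumes "finite A" "i \<in> A" "0 < k i"
  shows "Suc (\<Sum>j\<in>A. (k(i := k i - 1)) j) = (\<Sum>j\<in>A. k j)"
proof -
  have "(\<Sum>j\<in>A - {i}. (k(i := k i - 1)) j) = (\<Sum>j\<in>A - {i}. k j)"
    by (intro sum.cong) auto
  then show ?thesis
    using assms by (simp add: sum.remove[of A i])
qed

text \<open>This generalises Pascal's rule. Read combinatorially, a word with \<open>k i\<close> letters \<open>i\<close> is
  determined by its first letter and the remaining word.\<close>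

lemma multinom_rec:
  assumes "finite A" "0 < (\<Sum>i\<in>A. k i)"
  shows "multinom A k = (\<Sum>i\<in>{i\<in>A. 0 < k i}. multinom A (k(i := k i - 1)))"
proof -
  obtain n where n: "(\<Sum>i\<in>A. k i) = Suc n"
    using assms gr0_implies_Suc by blast
  define P :: nat where "P = (\<Prod>i\<in>A. fact (k i))"
  have "multinom A (k(i := k i - 1)) * P = k i * fact n" if i: "i \<in> A" "0 < k i" for i
  proof -
    let ?k = "k(i := k i - 1)"
    have "(\<Prod>j\<in>A - {i}. fact (?k j)) = (\<Prod>j\<in>A - {i}. fact (k j) :: nat)"
      by (intro prod.cong) auto
    then have "P = k i * (\<Prod>j\<in>A. fact (?k j))"
      using i assms(1) unfolding P_def
      by (simp add: prod.remove[of A i] fact_reduce)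
    moreover have "multinom A ?k * (\<Prod>j\<in>A. fact (?k j)) = fact n"
      using multinom_mult_prod_fact[of A ?k] sum_decrease[of A i k] assms(1) i n by simp
    ultimately show ?thesis
      by (simp add: mult.left_commute)
  qed
  then have "(\<Sum>i\<in>{i\<in>A. 0 < k i}. multinom A (k(i := k i - 1))) * P
      = (\<Sum>i\<in>{i\<in>A. 0 < k i}. k i) * fact n"
    by (simp add: sum_distrib_right)
  also have "(\<Sum>i\<in>{i\<in>A. 0 < k i}. k i) = (\<Sum>i\<in>A. k i)"
    using assms(1) by (intro sum.mono_neutral_left) auto
  also have "\<dots> * fact n = multinom A k * P"
    using multinom_mult_prod_fact[of A k] assms(1) n unfolding P_def by simp
  finally have "(\<Sum>i\<in>{i\<in>A. 0 < k i}. multinom A (k(i := k i - 1))) * P = multinom A k * P" .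
  moreover have "P \<noteq> 0"
    unfolding P_def by (simp add: prod_pos)
  ultimately show ?thesis
    by (metis mult_right_cancel)
qed

text \<open>The value 0 off \<open>A\<close> makes an exponent vector on \<open>A\<close> a unique function on the whole type.\<close>

definition compositions :: "'i set \<Rightarrow> nat \<Rightarrow> ('i \<Rightarrow> nat) set" where
  "compositions A n = {k. (\<forall>i. i \<notin> A \<longrightarrow> k i = 0) \<and> (\<Sum>i\<in>A. k i) = n}"

lemma finite_compositions:
  assumes "finite A"
  shows "finite (compositions A n)"
proof (rule finite_subset)
  show "compositions A n \<subseteq> {k. \<forall>i. (i \<in> A \<longrightarrow> k i \<in> {..n}) \<and> (i \<notin> A \<longrightarrow> k i = 0)}"
    using assms by (auto simp: compositions_def intro: member_le_sum)
  show "finite \<dots>"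
    using assms by (intro finite_set_of_finite_funs) auto
qed

lemma compositions_0: "finite A \<Longrightarrow> compositions A 0 = {\<lambda>_. 0}"
  by (auto simp: compositions_def fun_eq_iff)

text \<open>Multiplying by one more factor \<open>\<Sum>j\<in>A. z j\<close> raises one exponent, so the coefficient of a
  monomial collects those of its predecessors. This is again \<open>multinom_rec\<close>.\<close>

theorem multinomial_theorem:
  fixes z :: "'i \<Rightarrow> 'r::comm_semiring_1"
  assumes A: "finite A"
  shows "(\<Sum>i\<in>A. z i) ^ n
    = (\<Sum>k\<in>compositions A n. of_nat (multinom A k) * (\<Prod>i\<in>A. z i ^ k i))"
proof (induction n)
  case 0
  show ?case
    using A by (simp add: compositions_0 multinom_def)
next
  case (Suc n)
  let ?m = "\<lambda>k. \<Prod>i\<in>A. z i ^ k i"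
  have shift: "z j * (\<Sum>k\<in>compositions A n. of_nat (multinom A k) * ?m k)
      = (\<Sum>k\<in>{k\<in>compositions A (Suc n). 0 < k j}. of_nat (multinom A (k(j := k j - 1))) * ?m k)"
    (is "_ = ?R") if j: "j \<in> A" for j
  proof -
    have m: "?m (k(j := Suc (k j))) = z j * ?m k" for k
    proof -
      have "(\<Prod>i\<in>A - {j}. z i ^ (k(j := Suc (k j))) i) = (\<Prod>i\<in>A - {j}. z i ^ k i)"
        by (intro prod.cong) auto
      then show ?thesis
        using A j by (simp add: prod.remove[of A j] mult.assoc)
    qed
    have s: "(\<Sum>i\<in>A. (k(j := Suc (k j))) i) = Suc (\<Sum>i\<in>A. k i)" for k :: "'i \<Rightarrow> nat"
      using sum_decrease[of A j "k(j := Suc (k j))"] A j by simp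
    have "(\<Sum>k\<in>compositions A n. of_nat (multinom A k) * (z j * ?m k)) = ?R"
    proof (rule sum.reindex_bij_witness[where j = "\<lambda>k. k(j := Suc (k j))"
          and i = "\<lambda>k. k(j := k j - 1)"], goal_cases)
      case (2 k)
      then show ?case
        using s[of k] j by (auto simp: compositions_def)
    next
      case (4 k)
      then show ?case
        using sum_decrease[of A j k] A j by (auto simp: compositions_def)
    next
      case (5 k)
      then show ?case
        using m[of k] by simp
    qed auto
    then show ?thesis
      by (simp add: sum_distrib_left mult_ac)
  qed
  have "(\<Sum>i\<in>A. z i) ^ Suc n
      = (\<Sum>j\<in>A. z j * (\<Sum>k\<in>compositions A n. of_nat (multinom A k) * ?m k))"
    by (simp add: Suc sum_distrib_right)
  also have "\<dots> = (\<Sum>j\<in>A. \<Sum>k\<in>{k\<in>compositions A (Suc n). 0 < k j}.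
      of_nat (multinom A (k(j := k j - 1))) * ?m k)"
    by (intro sum.cong refl shift)
  also have "\<dots> = (\<Sum>k\<in>compositions A (Suc n). \<Sum>j\<in>{j\<in>A. 0 < k j}.
      of_nat (multinom A (k(j := k j - 1))) * ?m k)"
    by (rule sum.swap_restrict[OF A finite_compositions[OF A]])
  also have "\<dots> = (\<Sum>k\<in>compositions A (Suc n). of_nat (multinom A k) * ?m k)"
  proof (intro sum.cong refl)
    fix k assume "k \<in> compositions A (Suc n)"
    then have "0 < (\<Sum>i\<in>A. k i)"
      by (simp add: compositions_def)
    then show "(\<Sum>j\<in>{j\<in>A. 0 < k j}. of_nat (multinom A (k(j := k j - 1))) * ?m k)
        = of_nat (multinom A k) * ?m k"
      by (simp add: multinom_rec[OF A] of_nat_sum sum_distrib_right)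
  qed
  finally show ?case .
qed

section \<open>Leaves of trees\<close>

lemma card_2_other_element:
  assumes "card e = 2" "v \<in> e"
  obtains u where "u \<noteq> v" "e = {u, v}"
proof -
  obtain x y where xy: "e = {x, y}" "x \<noteq> y"
    using assms(1) by (auto simp: card_2_iff)
  then consider "v = x" | "v = y"
    using assms(2) by blast
  then show ?thesis
    using that[of x] that[of y] xy by cases (simp_all add: insert_commute)
qed

lemma graph_degree_1_iff:
  assumes "simple_graph V E"
  shows "graph_degree E v = 1 \<longleftrightarrow> (\<exists>u. u \<noteq> v \<and> {e\<in>E. v \<in> e} = {{u, v}})"
proof (intro iffI; (elim exE conjE)?)
  assume "graph_degree E v = 1"
  then obtain f where f: "{e\<in>E. v \<in> e} = {f}"
    unfolding graph_degree_def by (rule card_1_singletonE)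
  have "f \<in> {e\<in>E. v \<in> e}"
    unfolding f by simp
  then have "f \<in> E" "v \<in> f"
    by simp_all
  then have "card f = 2"
    using assms unfolding simple_graph_def by simp
  then obtain u where u: "u \<noteq> v" "f = {u, v}"
    using \<open>v \<in> f\<close> by (rule card_2_other_element)
  show "\<exists>u. u \<noteq> v \<and> {e\<in>E. v \<in> e} = {{u, v}}"
    unfolding f using u by (intro exI[of _ u] conjI) simp_all
next
  fix u
  assume "{e\<in>E. v \<in> e} = {{u, v}}"
  then show "graph_degree E v = 1"
    unfolding graph_degree_def by simp
qed

lemma simple_graph_finite: "simple_graph V E \<Longrightarrow> finite V \<Longrightarrow> finite E"
  unfolding simple_graph_def by (rule finite_subset[of _ "Pow V"]) auto

lemma sym_edges: "sym {(s, t). {s, t} \<in> E}"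
  by (auto simp: sym_def insert_commute)

lemma graph_degree_pos:
  assumes "graph_connected V E" "finite E" "x \<in> V" "y \<in> V" "x \<noteq> y"
  shows "0 < graph_degree E x"
proof -
  have "(x, y) \<in> {(s, t). {s, t} \<in> E}\<^sup>*"
    using assms unfolding graph_connected_def by blast
  then obtain z where "{x, z} \<in> E"
    using \<open>x \<noteq> y\<close> by (auto elim: converse_rtranclE)
  then have "{e\<in>E. x \<in> e} \<noteq> {}"
    by auto
  then show ?thesis
    using assms(2) by (simp add: graph_degree_def card_gt_0_iff)
qed

lemma graph_tree_remove_leaf:
  assumes tree: "graph_tree V E" and "u \<noteq> v" and leaf: "{e\<in>E. v \<in> e} = {{u, v}}"
  shows "graph_tree (V - {v}) (E - {{u, v}})"
proof -
  let ?E = "E - {{u, v}}"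
  have E: "simple_graph V E" "graph_connected V E" "\<not> (\<exists>c. graph_cycle E c)"
    using tree by (auto simp: graph_tree_def)
  have leaf_edge: "e = {u, v}" if "e \<in> E" "v \<in> e" for e
  proof -
    have "e \<in> {e\<in>E. v \<in> e}"
      using that by simp
    then show ?thesis
      unfolding leaf by simp
  qed
  have "{u, v} \<in> {e\<in>E. v \<in> e}"
    unfolding leaf by simp
  then have u: "u \<in> V"
    using E(1) by (auto simp: simple_graph_def)
  have "simple_graph (V - {v}) ?E"
    unfolding simple_graph_def
  proof
    fix e assume "e \<in> ?E"
    then have "e \<in> E" "v \<notin> e"
      using leaf_edge[of e] by auto
    then show "e \<subseteq> V - {v} \<and> card e = 2"
      using E(1) unfolding simple_graph_def by blast
  qed
  moreover have "graph_connected (V - {v}) ?E"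
  proof -
    \<comment> \<open>Contracting the leaf onto its neighbour turns paths of the tree into paths avoiding the leaf.\<close>
    define p where "p = (\<lambda>x. if x = v then u else x)"
    have "(p x, p y) \<in> {(s, t). {s, t} \<in> ?E}\<^sup>*" if "(x, y) \<in> {(s, t). {s, t} \<in> E}\<^sup>*" for x y
      using that
    proof (induction rule: rtrancl_induct)
      case (step y z)
      have "p y = p z \<or> {p y, p z} \<in> ?E"
      proof (cases "v \<in> {y, z}")
        case True
        then have "{y, z} = {u, v}"
          using step.hyps(2) by (intro leaf_edge) auto
        then show ?thesis
          by (auto simp: p_def doubleton_eq_iff)
      next
        case False
        then show ?thesis
          using step by (auto simp: p_def)
      qed
      then show ?case
        using step.IH by (auto intro: rtrancl_into_rtrancl)
    qed simp
    then have "(p x, p y) \<in> {(s, t). {s, t} \<in> ?E}\<^sup>*" if "x \<in> V" "y \<in> V" for x y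
      using E(2) that unfolding graph_connected_def by blast
    moreover have "p x = x" if "x \<in> V - {v}" for x
      using that by (simp add: p_def)
    ultimately have "\<forall>x\<in>V - {v}. \<forall>y\<in>V - {v}. (x, y) \<in> {(s, t). {s, t} \<in> ?E}\<^sup>*"
      by (metis DiffD1)
    moreover have "V - {v} \<noteq> {}"
      using u \<open>u \<noteq> v\<close> by blast
    ultimately show ?thesis
      unfolding graph_connected_def by blast
  qed
  moreover have "\<not> (\<exists>c. graph_cycle ?E c)"
    using E(3) unfolding graph_cycle_def by (metis DiffD1)
  ultimately show ?thesis
    by (simp add: graph_tree_def)
qed

text \<open>This keeps cycles away from leaves; it needs cycles to have length at least 3, so that
  predecessor and successor are different vertices.\<close>

lemma graph_cycle_two_neighbours:
  assumes c: "graph_cycle E c" and v: "v \<in> set c"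
  shows "\<exists>x y. x \<noteq> y \<and> {v, x} \<in> E \<and> {v, y} \<in> E"
proof -
  let ?n = "length c"
  obtain i where i: "i < ?n" "v = c ! i"
    using v by (auto simp: in_set_conv_nth)
  have n: "3 \<le> ?n" and dist: "distinct c"
    and edge: "\<And>i. i < ?n \<Longrightarrow> {c ! i, c ! (Suc i mod ?n)} \<in> E"
    using c by (auto simp: graph_cycle_def)
  define j where "j = (if i = 0 then ?n - 1 else i - 1)"
  have j: "j < ?n" "Suc j mod ?n = i"
    using i n by (auto simp: j_def)
  define k where "k = Suc i mod ?n"
  have "k < ?n" "k \<noteq> j"
    using i n by (cases "Suc i = ?n"; auto simp: j_def k_def)+
  then have "c ! k \<noteq> c ! j"
    using dist j by (simp add: nth_eq_iff_index_eq)
  moreover have "{v, c ! k} \<in> E" "{v, c ! j} \<in> E"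
    using edge[of i] edge[of j] i j by (simp_all add: k_def insert_commute)
  ultimately show ?thesis
    by blast
qed

lemma graph_tree_add_leaf:
  assumes tree: "graph_tree V E" and u: "u \<in> V" and v: "v \<notin> V"
  shows "graph_tree (insert v V) (insert {u, v} E)"
proof -
  let ?E = "insert {u, v} E" and ?R = "{(s, t). {s, t} \<in> insert {u, v} E}"
  have E: "simple_graph V E" "graph_connected V E" "\<not> (\<exists>c. graph_cycle E c)"
    using tree by (auto simp: graph_tree_def)
  have uv: "u \<noteq> v"
    using u v by blast
  have v_edge: "v \<notin> e" if "e \<in> E" for e
    using E(1) v that by (auto simp: simple_graph_def)
  have "simple_graph (insert v V) ?E"
    using E(1) u uv by (auto simp: simple_graph_def)
  moreover have "graph_connected (insert v V) ?E"
  proof -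
    have to_u: "(x, u) \<in> ?R\<^sup>*" if "x \<in> insert v V" for x
    proof (cases "x = v")
      case True
      then have "(x, u) \<in> ?R"
        by (simp add: insert_commute)
      then show ?thesis
        by blast
    next
      case False
      then have "(x, u) \<in> {(s, t). {s, t} \<in> E}\<^sup>*"
        using E(2) that u by (simp add: graph_connected_def)
      then show ?thesis
        by (rule rtrancl_mono[THEN subsetD, rotated]) auto
    qed
    moreover have "sym (?R\<^sup>*)"
      by (intro sym_rtrancl sym_edges)
    ultimately show ?thesis
      unfolding graph_connected_def by (blast dest: symD intro: rtrancl_trans)
  qed
  moreover have "\<not> graph_cycle ?E c" for c
  proof
    assume c: "graph_cycle ?E c"
    have "v \<notin> set c"
    proof
      assume "v \<in> set c"
      then obtain x y where "x \<noteq> y" "{v, x} \<in> ?E" "{v, y} \<in> ?E"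
        using graph_cycle_two_neighbours[OF c] by blast
      then show False
        using v_edge by (metis doubleton_eq_iff insertI1 insert_iff)
    qed
    then have "c ! i \<noteq> v" if "i < length c" for i
      using that by auto
    moreover have "Suc i mod length c < length c" if "i < length c" for i
      using that by (intro mod_less_divisor) auto
    ultimately have "graph_cycle E c"
      using c unfolding graph_cycle_def by (metis doubleton_eq_iff insert_iff)
    with E(3) show False
      by blast
  qed
  ultimately show ?thesis
    by (simp add: graph_tree_def)
qed

text \<open>A path of maximal length starts at a leaf: its first vertex has no neighbour off the path by
  maximality, and a neighbour on the path other than the second vertex would close a cycle.\<close>

lemma graph_tree_has_leaf:
  assumes tree: "graph_tree V E" and fin: "finite V" and two: "2 \<le> card V"
  shows "\<exists>v\<in>V. graph_degree E v = 1"
proof (rule ccontr)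
  assume no_leaf: "\<not> ?thesis"
  have E: "simple_graph V E" "graph_connected V E" "\<not> (\<exists>c. graph_cycle E c)"
    using tree by (auto simp: graph_tree_def)
  have finE: "finite E"
    using E(1) fin by (rule simple_graph_finite)
  have other: "\<exists>y\<in>V. y \<noteq> x \<and> y \<noteq> w \<and> {x, y} \<in> E" if x: "x \<in> V" for x w
  proof -
    have "V \<noteq> {x}"
      using two by auto
    then obtain x' where "x' \<in> V" "x' \<noteq> x"
      using x by blast
    then have "0 < graph_degree E x"
      using graph_degree_pos[OF E(2) finE x] by blast
    then have "2 \<le> card {e\<in>E. x \<in> e}"
      using no_leaf x unfolding graph_degree_def[symmetric]
      by (metis One_nat_def Suc_1 Suc_leI le_neq_implies_less)
    moreover have "card {e\<in>E. x \<in> e} \<le> 1" if "{e\<in>E. x \<in> e} \<subseteq> {{x, w}}"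
      using card_mono[OF _ that] by simp
    ultimately have "\<not> {e\<in>E. x \<in> e} \<subseteq> {{x, w}}"
      by linarith
    then obtain e where e: "e \<in> E" "x \<in> e" "e \<noteq> {x, w}"
      by blast
    then have "card e = 2" "e \<subseteq> V"
      using E(1) by (auto simp: simple_graph_def)
    obtain y where "y \<noteq> x" "e = {y, x}"
      using \<open>card e = 2\<close> e(2) by (rule card_2_other_element)
    then show ?thesis
      using e \<open>e \<subseteq> V\<close> by (auto simp: insert_commute)
  qed
  define path where "path = (\<lambda>xs. xs \<noteq> [] \<and> distinct xs \<and> set xs \<subseteq> V \<and>
    (\<forall>i. Suc i < length xs \<longrightarrow> {xs ! i, xs ! Suc i} \<in> E))"
  have "length xs \<le> card V" if "path xs" for xs
    using that fin card_mono distinct_card unfolding path_def by metis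
  moreover obtain v where "v \<in> V"
    using two by (metis all_not_in_conv card.empty not_numeral_le_zero)
  then have "path [v]"
    by (simp add: path_def)
  ultimately obtain xs where xs: "path xs" and max: "\<And>ys. path ys \<Longrightarrow> length ys \<le> length xs"
    using ex_has_greatest_nat[of path "[v]" length "Suc (card V)"]
    by (metis less_Suc_eq_le)
  let ?x = "xs ! 0"
  have "?x \<in> V"
    using xs by (auto simp: path_def)
  then obtain y where y: "y \<in> V" "y \<noteq> ?x" "y \<noteq> xs ! 1" "{?x, y} \<in> E"
    using other by blast
  have "y \<in> set xs"
  proof (rule ccontr)
    assume "y \<notin> set xs"
    then have "path (y # xs)"
      using xs y by (auto simp: path_def nth_Cons insert_commute split: nat.split)
    then show False
      using max[of "y # xs"] by simp
  qed
  then obtain i where i: "i < length xs" "y = xs ! i"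
    by (auto simp: in_set_conv_nth)
  have "i \<noteq> 0" "i \<noteq> 1"
    using y(2,3) i(2) by metis+
  have "graph_cycle E (take (Suc i) xs)"
    unfolding graph_cycle_def
  proof (intro conjI allI impI)
    show "3 \<le> length (take (Suc i) xs)"
      using i(1) \<open>i \<noteq> 0\<close> \<open>i \<noteq> 1\<close> by simp
    show "distinct (take (Suc i) xs)"
      using xs by (simp add: path_def)
  next
    fix j
    assume "j < length (take (Suc i) xs)"
    then have "j \<le> i"
      by simp
    show "{take (Suc i) xs ! j, take (Suc i) xs ! (Suc j mod length (take (Suc i) xs))} \<in> E"
    proof (cases "j = i")
      case True
      then show ?thesis
        using i y(4) by (simp add: insert_commute)
    next
      case False
      then show ?thesis
        using xs i(1) \<open>j \<le> i\<close> by (simp add: path_def)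
    qed
  qed
  with E(3) show False
    by blast
qed

lemma card_edges_graph_tree:
  assumes "graph_tree V E" "finite V"
  shows "Suc (card E) = card V"
  using assms
proof (induction "card V" arbitrary: V E rule: less_induct)
  case less
  have E: "simple_graph V E" "V \<noteq> {}"
    using less.prems by (auto simp: graph_tree_def graph_connected_def)
  show ?case
  proof (cases "2 \<le> card V")
    case True
    then obtain v u where v: "v \<in> V" "u \<noteq> v" "{e\<in>E. v \<in> e} = {{u, v}}"
      using graph_tree_has_leaf[OF less.prems] graph_degree_1_iff[OF E(1)] by blast
    have "Suc (card (E - {{u, v}})) = card (V - {v})"
      using v less.prems by (intro less.hyps graph_tree_remove_leaf card_Diff1_less) auto
    moreover have "{u, v} \<in> E" "finite E"
      using v simple_graph_finite[OF E(1) less.prems(2)] by auto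
    ultimately show ?thesis
      using v less.prems(2) by (metis card_Suc_Diff1)
  next
    case False
    then have "card V = 1"
      using E(2) less.prems(2) card_gt_0_iff[of V] by linarith
    moreover have "e \<notin> E" for e
      using E(1) card_mono[OF less.prems(2), of e] False by (auto simp: simple_graph_def)
    then have "E = {}"
      by blast
    ultimately show ?thesis
      by simp
  qed
qed

section \<open>Bipartite trees with prescribed degrees\<close>

definition trees_with_degrees :: "'v set \<Rightarrow> 'v set \<Rightarrow> ('v \<Rightarrow> nat) \<Rightarrow> 'v set set set" where
  "trees_with_degrees U V d =
     {T \<in> bipartite_trees U V. \<forall>x\<in>U \<union> V. graph_degree T x = Suc (d x)}"

lemma bipartite_trees_commute: "bipartite_trees U V = bipartite_trees V U"
proof -
  have "(\<exists>u\<in>U. \<exists>v\<in>V. e = {u, v}) \<longleftrightarrow> (\<exists>v\<in>V. \<exists>u\<in>U. e = {v, u})" for e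
    by (metis insert_commute)
  then show ?thesis
    by (simp add: bipartite_trees_def Un_commute)
qed

lemma trees_with_degrees_commute: "trees_with_degrees U V d = trees_with_degrees V U d"
  unfolding trees_with_degrees_def by (simp add: bipartite_trees_commute[of U V] Un_commute)

lemma bipartite_trees_subset: "bipartite_trees U V \<subseteq> Pow (Pow (U \<union> V))"
  unfolding bipartite_trees_def graph_tree_def simple_graph_def by auto

lemma finite_bipartite_trees: "finite U \<Longrightarrow> finite V \<Longrightarrow> finite (bipartite_trees U V)"
  by (rule finite_subset[OF bipartite_trees_subset]) simp

lemma bipartite_tree_avoids:
  "T \<in> bipartite_trees U V \<Longrightarrow> v \<notin> U \<union> V \<Longrightarrow> e \<in> T \<Longrightarrow> v \<notin> e"
  using bipartite_trees_subset[of U V] by blast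

lemma graph_degree_add_leaf:
  assumes "finite T" "\<And>e. e \<in> T \<Longrightarrow> v \<notin> e" "u \<noteq> v"
  shows "graph_degree (insert {u, v} T) x
    = (if x = v then 1 else if x = u then Suc (graph_degree T u) else graph_degree T x)"
proof -
  have new: "{u, v} \<notin> T"
    using assms(2) by blast
  consider "x = v" | "x = u" | "x \<noteq> u" "x \<noteq> v"
    by blast
  then show ?thesis
  proof cases
    case 1
    then have "{e\<in>insert {u, v} T. x \<in> e} = {{u, v}}"
      using assms(2) by auto
    then show ?thesis
      using 1 by (simp add: graph_degree_def)
  next
    case 2
    then have "{e\<in>insert {u, v} T. x \<in> e} = insert {u, v} {e\<in>T. x \<in> e}"
      by auto
    then show ?thesis
      using 2 assms(1,3) new by (simp add: graph_degree_def)
  next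
    case 3
    then have "{e\<in>insert {u, v} T. x \<in> e} = {e\<in>T. x \<in> e}"
      by auto
    then show ?thesis
      using 3 by (simp add: graph_degree_def)
  qed
qed

lemma bipartite_trees_add_leaf:
  assumes T: "T \<in> bipartite_trees U (V - {v})" and u: "u \<in> U" and v: "v \<in> V" and disj: "U \<inter> V = {}"
  shows "insert {u, v} T \<in> bipartite_trees U V"
proof -
  have "insert v (U \<union> (V - {v})) = U \<union> V"
    using v by blast
  moreover have "v \<notin> U \<union> (V - {v})"
    using v disj by blast
  ultimately have "graph_tree (U \<union> V) (insert {u, v} T)"
    using graph_tree_add_leaf[of "U \<union> (V - {v})" T u v] T u by (simp add: bipartite_trees_def)
  moreover have "\<exists>u\<in>U. \<exists>v\<in>V. e = {u, v}" if "e \<in> insert {u, v} T" for e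
    using that T u v unfolding bipartite_trees_def by blast
  ultimately show ?thesis
    by (simp add: bipartite_trees_def)
qed

lemma bipartite_trees_remove_leaf:
  assumes T: "T \<in> bipartite_trees U V" and v: "v \<in> V" and disj: "U \<inter> V = {}"
    and leaf: "graph_degree T v = 1"
  obtains u T' where "u \<in> U" "T' \<in> bipartite_trees U (V - {v})" "T = insert {u, v} T'"
proof -
  have tree: "graph_tree (U \<union> V) T" and bip: "\<And>e. e \<in> T \<Longrightarrow> \<exists>u\<in>U. \<exists>w\<in>V. e = {u, w}"
    using T by (auto simp: bipartite_trees_def)
  then obtain u where u: "u \<noteq> v" "{e\<in>T. v \<in> e} = {{u, v}}"
    using leaf graph_degree_1_iff[of "U \<union> V" T v] by (auto simp: graph_tree_def)
  have "{u, v} \<in> {e\<in>T. v \<in> e}"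
    unfolding u(2) by simp
  then have uv: "{u, v} \<in> T"
    by simp
  have "v \<notin> U"
    using v disj by blast
  then have "u \<in> U"
    using bip[OF uv] by (auto simp: doubleton_eq_iff)
  moreover have "T - {{u, v}} \<in> bipartite_trees U (V - {v})"
  proof -
    have "U \<union> (V - {v}) = U \<union> V - {v}"
      using \<open>v \<notin> U\<close> by blast
    then have "graph_tree (U \<union> (V - {v})) (T - {{u, v}})"
      using graph_tree_remove_leaf[OF tree u] by simp
    moreover have "\<exists>a\<in>U. \<exists>w\<in>V - {v}. e = {a, w}" if e: "e \<in> T - {{u, v}}" for e
    proof -
      obtain a w where aw: "a \<in> U" "w \<in> V" "e = {a, w}"
        using bip[of e] e by blast
      have "e \<notin> {e\<in>T. v \<in> e}"
        unfolding u(2) using e by simp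
      then have "w \<noteq> v"
        using aw e by auto
      then show ?thesis
        using aw by blast
    qed
    ultimately show ?thesis
      by (simp add: bipartite_trees_def)
  qed
  moreover have "T = insert {u, v} (T - {{u, v}})"
    using uv by blast
  ultimately show ?thesis
    by (rule that)
qed

lemma bipartite_tree_degree_pos:
  assumes "T \<in> bipartite_trees U V" "finite U" "finite V" "U \<inter> V = {}" "U \<noteq> {}" "V \<noteq> {}"
    and "x \<in> U \<union> V"
  shows "0 < graph_degree T x"
proof -
  have T: "simple_graph (U \<union> V) T" "graph_connected (U \<union> V) T"
    using assms(1) by (auto simp: bipartite_trees_def graph_tree_def)
  obtain y where "y \<in> U \<union> V" "x \<noteq> y"
    using assms(4-7) by blast
  then show ?thesis
    using graph_degree_pos[OF T(2) simple_graph_finite[OF T(1)], of x y] assms by simp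
qed

text \<open>The vertex \<open>v\<close> is a leaf of each of these trees. Its neighbour \<open>u\<close> must have \<open>0 < d u\<close>, because the
  rest of the tree is connected and has further vertices, so \<open>u\<close> has a neighbour other than \<open>v\<close>.\<close>

lemma trees_with_degrees_remove_leaf:
  assumes fin: "finite U" "finite V" and disj: "U \<inter> V = {}" and ne: "U \<noteq> {}" "V - {v} \<noteq> {}"
    and v: "v \<in> V" "d v = 0"
  shows "trees_with_degrees U V d = (\<Union>u\<in>{u\<in>U. 0 < d u}.
      insert {u, v} ` trees_with_degrees U (V - {v}) (d(u := d u - 1)))" (is "_ = ?R")
proof -
  have v': "v \<notin> U"
    using v disj by blast
  then have v'': "v \<notin> U \<union> (V - {v})"
    by blast
  have degree: "graph_degree (insert {u, v} T) x = (if x = v then 1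
      else if x = u then Suc (graph_degree T u) else graph_degree T x)"
    if "T \<in> bipartite_trees U (V - {v})" "u \<in> U" for u T x
  proof (rule graph_degree_add_leaf)
    show "finite T"
      using that(1) fin bipartite_trees_subset by (metis PowD finite_Diff finite_Pow_iff
          finite_UnI finite_subset subsetD)
    show "u \<noteq> v"
      using that v' by blast
    show "v \<notin> e" if "e \<in> T" for e
      using bipartite_tree_avoids[OF \<open>T \<in> _\<close> v'' that] .
  qed
  show ?thesis
  proof (intro Set.equalityI subsetI)
    fix T assume "T \<in> trees_with_degrees U V d"
    then have T: "T \<in> bipartite_trees U V" "\<And>x. x \<in> U \<union> V \<Longrightarrow> graph_degree T x = Suc (d x)"
      by (auto simp: trees_with_degrees_def)
    then have "graph_degree T v = 1"
      using v by simp
    then obtain u T' where u: "u \<in> U" and T': "T' \<in> bipartite_trees U (V - {v})"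
      and eq: "T = insert {u, v} T'"
      using bipartite_trees_remove_leaf[OF T(1) v(1) disj] by blast
    have uv: "u \<noteq> v"
      using u v' by blast
    have "Suc (d u) = Suc (graph_degree T' u)"
      using T(2)[of u] degree[OF T' u, of u] u uv eq by simp
    moreover have "0 < graph_degree T' u"
      using bipartite_tree_degree_pos[OF T'] fin disj ne u by blast
    ultimately have du: "0 < d u" "graph_degree T' u = Suc (d u - 1)"
      by simp_all
    have "graph_degree T' x = Suc ((d(u := d u - 1)) x)" if x: "x \<in> U \<union> (V - {v})" for x
    proof (cases "x = u")
      case False
      have "x \<noteq> v" "x \<in> U \<union> V"
        using x v' by auto
      then show ?thesis
        using T(2)[of x] degree[OF T' u, of x] False eq by simp
    qed (use du in simp)
    then have "T' \<in> trees_with_degrees U (V - {v}) (d(u := d u - 1))"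
      using T' by (simp add: trees_with_degrees_def)
    then show "T \<in> ?R"
      using u du(1) eq by blast
  next
    fix T assume "T \<in> ?R"
    then obtain u T' where u: "u \<in> U" "0 < d u" and eq: "T = insert {u, v} T'"
      and T': "T' \<in> bipartite_trees U (V - {v})"
      and deg: "\<And>x. x \<in> U \<union> (V - {v}) \<Longrightarrow> graph_degree T' x = Suc ((d(u := d u - 1)) x)"
      by (auto simp: trees_with_degrees_def)
    have "graph_degree T x = Suc (d x)" if x: "x \<in> U \<union> V" for x
    proof (cases "x = v")
      case True
      then show ?thesis
        using degree[OF T' u(1), of x] eq v by simp
    next
      case False
      then have "x \<in> U \<union> (V - {v})"
        using x by blast
      then show ?thesis
        using degree[OF T' u(1), of x] deg[of x] False eq u by auto
    qed
    then show "T \<in> trees_with_degrees U V d"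
      using bipartite_trees_add_leaf[OF T' u(1) v(1) disj] eq by (simp add: trees_with_degrees_def)
  qed
qed

lemma card_trees_with_degrees_remove_leaf:
  assumes fin: "finite U" "finite V" and disj: "U \<inter> V = {}" and ne: "U \<noteq> {}" "V - {v} \<noteq> {}"
    and v: "v \<in> V" "d v = 0"
  shows "card (trees_with_degrees U V d)
    = (\<Sum>u\<in>{u\<in>U. 0 < d u}. card (trees_with_degrees U (V - {v}) (d(u := d u - 1))))"
proof -
  let ?S = "\<lambda>u. trees_with_degrees U (V - {v}) (d(u := d u - 1))"
  have v': "v \<notin> U \<union> (V - {v})"
    using v disj by blast
  have avoid: "v \<notin> e" if "T \<in> ?S u" "e \<in> T" for u T e
    using bipartite_tree_avoids[OF _ v' that(2)] that(1) by (simp add: trees_with_degrees_def)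
  \<comment> \<open>The edge at \<open>v\<close> determines \<open>u\<close>, and the other edges determine the smaller tree.\<close>
  have inj: "u = w \<and> S = T" if "S \<in> ?S u" "T \<in> ?S w" "insert {u, v} S = insert {w, v} T" for u w S T
  proof -
    have "{u, v} \<notin> S" "{w, v} \<notin> S" "{u, v} \<notin> T" "{w, v} \<notin> T"
      using avoid that(1,2) by blast+
    then have "{u, v} = {w, v}"
      using that(3) by (metis insert_iff)
    then have "u = w"
      by (auto simp: doubleton_eq_iff)
    with that(3) \<open>{u, v} \<notin> S\<close> \<open>{u, v} \<notin> T\<close> show ?thesis
      by (simp add: insert_ident)
  qed
  have finS: "finite (?S u)" for u
    using finite_bipartite_trees[of U "V - {v}"] fin by (simp add: trees_with_degrees_def)
  have "card (trees_with_degrees U V d) = (\<Sum>u\<in>{u\<in>U. 0 < d u}. card (insert {u, v} ` ?S u))"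
    unfolding trees_with_degrees_remove_leaf[of U V v d, OF assms]
  proof (intro card_UN_disjoint ballI impI)
    fix u w assume "u \<in> {u\<in>U. 0 < d u}" "w \<in> {u\<in>U. 0 < d u}" "u \<noteq> w"
    then show "insert {u, v} ` ?S u \<inter> insert {w, v} ` ?S w = {}"
      using inj by blast
  qed (use fin finS in simp_all)
  also have "\<dots> = (\<Sum>u\<in>{u\<in>U. 0 < d u}. card (?S u))"
    using inj by (intro sum.cong refl card_image inj_onI) blast
  finally show ?thesis .
qed

lemma trees_with_degrees_single_edge:
  assumes "u \<noteq> v" "d u = 0" "d v = 0"
  shows "trees_with_degrees {u} {v} d = {{{u, v}}}"
proof -
  have "graph_tree {u} {}"
    by (auto simp: graph_tree_def simple_graph_def graph_connected_def graph_cycle_def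
        intro!: exI[of _ 0])
  then have "graph_tree ({u} \<union> {v}) {{u, v}}"
    using graph_tree_add_leaf[of "{u}" "{}" u v] assms(1) by (simp add: insert_commute)
  then have "{{u, v}} \<in> bipartite_trees {u} {v}"
    unfolding bipartite_trees_def by simp
  moreover have "{e \<in> {{u, v}}. x \<in> e} = {{u, v}}" if "x \<in> {u, v}" for x
    using that by auto
  then have "graph_degree {{u, v}} x = 1" if "x \<in> {u, v}" for x
    using that by (simp add: graph_degree_def)
  ultimately have "{{u, v}} \<in> trees_with_degrees {u} {v} d"
    using assms by (simp add: trees_with_degrees_def)
  moreover have "T = {{u, v}}" if T: "T \<in> trees_with_degrees {u} {v} d" for T
  proof -
    have "T \<subseteq> {{u, v}}"
      using T by (auto simp: trees_with_degrees_def bipartite_trees_def)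
    moreover have "graph_degree T u = 1"
      using T assms by (simp add: trees_with_degrees_def)
    then have "T \<noteq> {}"
      by (auto simp: graph_degree_def)
    ultimately show ?thesis
      by blast
  qed
  ultimately show ?thesis
    by blast
qed

text \<open>The induction step for a leaf in \<open>V\<close>. Leaves in \<open>U\<close> are reduced to it by exchanging the sides,
  which is why the induction hypothesis is an explicit premise here.\<close>

lemma card_trees_with_degrees_step:
  assumes fin: "finite U" "finite V" and disj: "U \<inter> V = {}" and ne: "U \<noteq> {}"
    and two: "2 \<le> card V"
    and sums: "Suc (\<Sum>x\<in>U. d x) = card V" "Suc (\<Sum>x\<in>V. d x) = card U"
    and v: "v \<in> V" "d v = 0"
    and IH: "\<And>d. Suc (\<Sum>x\<in>U. d x) = card (V - {v}) \<Longrightarrow> Suc (\<Sum>x\<in>V - {v}. d x) = card U \<Longrightarrow>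
      card (trees_with_degrees U (V - {v}) d) = multinom U d * multinom (V - {v}) d"
  shows "card (trees_with_degrees U V d) = multinom U d * multinom V d"
proof -
  have smaller: "card (trees_with_degrees U (V - {v}) (d(u := d u - 1)))
      = multinom U (d(u := d u - 1)) * multinom V d" if u: "u \<in> U" "0 < d u" for u
  proof -
    let ?d = "d(u := d u - 1)"
    have off: "?d x = d x" if "x \<in> V" for x
      using that u disj by auto
    have "card V = Suc (card (V - {v}))"
      using card_Suc_Diff1[OF fin(2) v(1)] by simp
    then have "Suc (\<Sum>x\<in>U. ?d x) = card (V - {v})"
      using sums(1) sum_decrease[OF fin(1) u(1), of d] u by simp
    moreover have "(\<Sum>x\<in>V - {v}. ?d x) = (\<Sum>x\<in>V. d x)"
      using off v fin by (simp add: sum.remove[OF fin(2) v(1)])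
    ultimately have "card (trees_with_degrees U (V - {v}) ?d)
        = multinom U ?d * multinom (V - {v}) ?d"
      using sums(2) by (intro IH) simp_all
    also have "multinom (V - {v}) ?d = multinom (V - {v}) d"
      using off by (intro multinom_cong) auto
    also have "\<dots> = multinom V d"
      using fin v by (simp add: multinom_remove_0)
    finally show ?thesis .
  qed
  have "V - {v} \<noteq> {}"
    using two card_Diff_singleton[OF v(1)] by (metis card.empty diff_is_0_eq not_less_eq_eq numeral_2_eq_2 One_nat_def)
  then have "card (trees_with_degrees U V d)
      = (\<Sum>u\<in>{u\<in>U. 0 < d u}. multinom U (d(u := d u - 1)) * multinom V d)"
    using card_trees_with_degrees_remove_leaf[of U V v d] fin disj ne v smaller by simp
  also have "\<dots> = multinom U d * multinom V d"
    using sums two fin by (simp add: multinom_rec[of U d] sum_distrib_right)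
  finally show ?thesis .
qed

theorem card_trees_with_degrees:
  assumes "finite U" "finite V" "U \<inter> V = {}" "U \<noteq> {}" "V \<noteq> {}"
    and "Suc (\<Sum>x\<in>U. d x) = card V" "Suc (\<Sum>x\<in>V. d x) = card U"
  shows "card (trees_with_degrees U V d) = multinom U d * multinom V d"
  using assms
proof (induction "card U + card V" arbitrary: U V d rule: less_induct)
  case less
  note fin = less.prems(1,2) and disj = less.prems(3) and ne = less.prems(4,5)
    and sums = less.prems(6,7)
  have step_V: ?case if v: "v \<in> V" "d v = 0" and two: "2 \<le> card V" for v
  proof (rule card_trees_with_degrees_step[OF fin disj ne(1) two sums v])
    fix d' :: "'a \<Rightarrow> nat"
    assume "Suc (\<Sum>x\<in>U. d' x) = card (V - {v})" "Suc (\<Sum>x\<in>V - {v}. d' x) = card U"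
    moreover have "card (V - {v}) < card V"
      using fin(2) v(1) by (rule card_Diff1_less)
    moreover have "V - {v} \<noteq> {}"
      using calculation(1) by force
    ultimately show "card (trees_with_degrees U (V - {v}) d') = multinom U d' * multinom (V - {v}) d'"
      using fin disj ne by (intro less.hyps) auto
  qed
  have step_U: ?case if u: "u \<in> U" "d u = 0" and two: "2 \<le> card U" for u
  proof -
    have "card (trees_with_degrees V U d) = multinom V d * multinom U d"
    proof (rule card_trees_with_degrees_step[OF fin(2,1) _ ne(2) two sums(2,1) u])
      show "V \<inter> U = {}"
        using disj by blast
      fix d' :: "'a \<Rightarrow> nat"
      assume "Suc (\<Sum>x\<in>V. d' x) = card (U - {u})" "Suc (\<Sum>x\<in>U - {u}. d' x) = card V"
      moreover have "card (U - {u}) < card U"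
        using fin(1) u(1) by (rule card_Diff1_less)
      moreover have "U - {u} \<noteq> {}"
        using calculation(1) by force
      ultimately show "card (trees_with_degrees V (U - {u}) d') = multinom V d' * multinom (U - {u}) d'"
        using fin disj ne by (intro less.hyps) auto
    qed
    then show ?case
      by (simp add: trees_with_degrees_commute[of U V] mult.commute)
  qed
  have no_zero: "card A \<le> (\<Sum>x\<in>A. d x)" if "\<And>x. x \<in> A \<Longrightarrow> d x \<noteq> 0" for A
    using sum_mono[of A "\<lambda>_. 1" d] that by (simp add: Suc_leI)
  have pos: "0 < card U" "0 < card V"
    using fin ne by (simp_all add: card_gt_0_iff)
  \<comment> \<open>The larger side has a vertex of degree 1, since its excess degrees sum to less than its size.\<close>
  consider v where "v \<in> V" "d v = 0" "2 \<le> card V" | u where "u \<in> U" "d u = 0" "2 \<le> card U"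
    | "card U = 1" "card V = 1"
  proof (cases "card U \<le> card V")
    case True
    then have "(\<Sum>x\<in>V. d x) < card V"
      using sums by linarith
    then obtain v where "v \<in> V" "d v = 0"
      using no_zero[of V] by (meson leD)
    then show ?thesis
      using that(1,3) True pos by fastforce
  next
    case False
    then have "(\<Sum>x\<in>U. d x) < card U"
      using sums by linarith
    then obtain u where "u \<in> U" "d u = 0"
      using no_zero[of U] by (meson leD)
    then show ?thesis
      using that(2) False pos by fastforce
  qed
  then show ?case
  proof cases
    case 3
    then obtain u v where uv: "U = {u}" "V = {v}"
      by (metis card_1_singletonE)
    then have "d u = 0" "d v = 0"
      using sums by simp_all
    then show ?thesis
      using uv disj trees_with_degrees_single_edge[of u v d] by (simp add: multinom_def)
  qed (rule step_V step_U; assumption)+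
qed

section \<open>The generating function by degrees\<close>

lemma sum_degrees_side:
  assumes "finite U" "finite V" "U \<inter> V = {}" and T: "T \<in> bipartite_trees U V"
  shows "(\<Sum>u\<in>U. graph_degree T u) = card T"
proof -
  have "finite T"
    using T assms simple_graph_finite[of "U \<union> V" T] by (simp add: bipartite_trees_def graph_tree_def)
  have edge: "\<exists>u\<in>U. \<exists>v\<in>V. e = {u, v}" if "e \<in> T" for e
    using T that by (simp add: bipartite_trees_def)
  have unique: "u = w" if "e \<in> T" "u \<in> U" "w \<in> U" "u \<in> e" "w \<in> e" for e u w
    using edge[OF that(1)] that(2-) assms(3) by auto
  have "(\<Sum>u\<in>U. card {e\<in>T. u \<in> e}) = card (\<Union>u\<in>U. {e\<in>T. u \<in> e})"
  proof (intro card_UN_disjoint[symmetric] ballI impI)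
    fix u w assume "u \<in> U" "w \<in> U" "u \<noteq> w"
    then show "{e\<in>T. u \<in> e} \<inter> {e\<in>T. w \<in> e} = {}"
      using unique[of _ u w] by auto
  qed (use assms(1) \<open>finite T\<close> in simp_all)
  also have "(\<Union>u\<in>U. {e\<in>T. u \<in> e}) = T"
    using edge by fastforce
  finally show ?thesis
    by (simp add: graph_degree_def)
qed

lemma sum_excess_degrees_side:
  assumes "finite U" "finite V" "U \<inter> V = {}" "U \<noteq> {}" "V \<noteq> {}" and T: "T \<in> bipartite_trees U V"
  shows "(\<Sum>u\<in>U. graph_degree T u - 1) = card V - 1"
proof -
  have "(\<Sum>u\<in>U. graph_degree T u - 1) = (\<Sum>u\<in>U. graph_degree T u) - (\<Sum>u\<in>U. 1)"
    using bipartite_tree_degree_pos[OF T assms(1-5)]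
    by (intro sum_subtractf_nat) (simp add: Suc_leI)
  also have "\<dots> = card T - card U"
    using sum_degrees_side[OF assms(1-3) T] by simp
  also have "Suc (card T) = card U + card V"
    using card_edges_graph_tree[of "U \<union> V" T] T assms(1-3)
    by (simp add: bipartite_trees_def card_Un_disjoint)
  then have "card T - card U = card V - 1"
    by linarith
  finally show ?thesis .
qed

text \<open>A pair of exponent vectors that occurs on the right-hand side belongs to a possible degree
  sequence, and conversely, so both sides are sums over the same pairs.\<close>

theorem bipartite_tree_degree_enumerator:
  fixes z :: "'v \<Rightarrow> 'r::comm_semiring_1"
  assumes fin: "finite U" "finite V" and disj: "U \<inter> V = {}" and ne: "U \<noteq> {}" "V \<noteq> {}"
  shows "(\<Sum>T\<in>bipartite_trees U V.
      (\<Prod>u\<in>U. z u ^ (graph_degree T u - 1)) * (\<Prod>v\<in>V. z v ^ (graph_degree T v - 1)))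
    = (\<Sum>u\<in>U. z u) ^ (card V - 1) * (\<Sum>v\<in>V. z v) ^ (card U - 1)"
proof -
  define excess :: "'v set \<Rightarrow> 'v set set \<Rightarrow> 'v \<Rightarrow> nat"
    where "excess = (\<lambda>A T x. if x \<in> A then graph_degree T x - 1 else 0)"
  let ?mon = "\<lambda>A k. \<Prod>x\<in>A. z x ^ k x"
  let ?K = "compositions U (card V - 1)" and ?L = "compositions V (card U - 1)"
  let ?g = "\<lambda>T. (excess U T, excess V T)"
  have disj': "V \<inter> U = {}"
    using disj by blast
  have card: "0 < card U" "0 < card V"
    using fin ne by (simp_all add: card_gt_0_iff)
  have image: "?g ` bipartite_trees U V \<subseteq> ?K \<times> ?L"
  proof safe
    fix T assume T: "T \<in> bipartite_trees U V"
    then show "excess U T \<in> ?K"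
      using sum_excess_degrees_side[OF fin disj ne T] by (simp add: compositions_def excess_def)
    show "excess V T \<in> ?L"
      using sum_excess_degrees_side[OF fin(2,1) disj' ne(2,1)] T
      by (simp add: compositions_def excess_def bipartite_trees_commute[of V U])
  qed
  have fibre: "{T \<in> bipartite_trees U V. ?g T = (k, l)}
      = trees_with_degrees U V (\<lambda>x. if x \<in> U then k x else l x)"
    if kl: "k \<in> ?K" "l \<in> ?L" for k l
  proof (intro Set.equalityI subsetI)
    fix T assume "T \<in> {T \<in> bipartite_trees U V. ?g T = (k, l)}"
    then have T: "T \<in> bipartite_trees U V" and kl: "k = excess U T" "l = excess V T"
      by auto
    have "graph_degree T x = Suc (if x \<in> U then k x else l x)" if "x \<in> U \<union> V" for x
      using bipartite_tree_degree_pos[OF T fin disj ne that] that unfolding kl excess_def by auto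
    then show "T \<in> trees_with_degrees U V (\<lambda>x. if x \<in> U then k x else l x)"
      using T by (simp add: trees_with_degrees_def)
  next
    fix T assume "T \<in> trees_with_degrees U V (\<lambda>x. if x \<in> U then k x else l x)"
    then have T: "T \<in> bipartite_trees U V"
      and deg: "\<And>x. x \<in> U \<union> V \<Longrightarrow> graph_degree T x = Suc (if x \<in> U then k x else l x)"
      by (auto simp: trees_with_degrees_def)
    have "excess U T x = k x" for x
      using deg[of x] kl(1) by (simp add: excess_def compositions_def)
    moreover have "excess V T x = l x" for x
      using deg[of x] kl(2) disj by (auto simp: excess_def compositions_def)
    ultimately have "?g T = (k, l)"
      by (simp add: fun_eq_iff)
    then show "T \<in> {T \<in> bipartite_trees U V. ?g T = (k, l)}"
      using T by simp
  qed
  have count: "card {T \<in> bipartite_trees U V. ?g T = (k, l)} = multinom U k * multinom V l"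
    if kl: "k \<in> ?K" "l \<in> ?L" for k l
  proof -
    let ?d = "\<lambda>x. if x \<in> U then k x else l x"
    have V: "?d x = l x" if "x \<in> V" for x
      using that disj by auto
    have "(\<Sum>x\<in>U. ?d x) = card V - 1" "(\<Sum>x\<in>V. ?d x) = card U - 1"
      using kl V by (simp_all add: compositions_def)
    then have "card (trees_with_degrees U V ?d) = multinom U ?d * multinom V ?d"
      using card by (intro card_trees_with_degrees[OF fin disj ne]) simp_all
    also have "\<dots> = multinom U k * multinom V l"
      using V by (intro arg_cong2[where f = "(*)"] multinom_cong) simp_all
    finally show ?thesis
      by (simp only: fibre[OF kl])
  qed
  have mon: "?mon A (\<lambda>x. graph_degree T x - 1) = ?mon A (excess A T)" for A T
    by (intro prod.cong) (simp_all add: excess_def)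
  have "(\<Sum>T\<in>bipartite_trees U V.
      ?mon U (\<lambda>x. graph_degree T x - 1) * ?mon V (\<lambda>x. graph_degree T x - 1))
    = (\<Sum>T\<in>bipartite_trees U V. ?mon U (excess U T) * ?mon V (excess V T))"
    unfolding mon ..
  also have "\<dots> = (\<Sum>p\<in>?K \<times> ?L. \<Sum>T\<in>{T \<in> bipartite_trees U V. ?g T = p}.
      ?mon U (excess U T) * ?mon V (excess V T))"
    using image fin
    by (intro sum.group[symmetric] finite_bipartite_trees finite_cartesian_product finite_compositions)
  also have "\<dots> = (\<Sum>(k, l)\<in>?K \<times> ?L.
      (of_nat (multinom U k) * ?mon U k) * (of_nat (multinom V l) * ?mon V l))"
  proof (intro sum.cong refl, clarify)
    fix k l assume kl: "k \<in> ?K" "l \<in> ?L"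
    have "(\<Sum>T\<in>{T \<in> bipartite_trees U V. ?g T = (k, l)}. ?mon U (excess U T) * ?mon V (excess V T))
        = (\<Sum>T\<in>{T \<in> bipartite_trees U V. ?g T = (k, l)}. ?mon U k * ?mon V l)"
      by (intro sum.cong) auto
    also have "\<dots> = of_nat (multinom U k * multinom V l) * (?mon U k * ?mon V l)"
      by (simp only: sum_constant count[OF kl])
    finally show "(\<Sum>T\<in>{T \<in> bipartite_trees U V. ?g T = (k, l)}.
        ?mon U (excess U T) * ?mon V (excess V T))
      = (of_nat (multinom U k) * ?mon U k) * (of_nat (multinom V l) * ?mon V l)"
      by (simp add: mult_ac)
  qed
  also have "\<dots> = (\<Sum>u\<in>U. z u) ^ (card V - 1) * (\<Sum>v\<in>V. z v) ^ (card U - 1)"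
    unfolding multinomial_theorem[OF fin(1)] multinomial_theorem[OF fin(2)]
    by (simp add: sum_product sum.cartesian_product)
  finally show ?thesis .
qed

theorem theorem1p5:
  fixes a b :: nat
  shows "(\<forall>\<alpha> \<beta> :: nat \<Rightarrow> nat.
            b = (\<Sum>i=0..a. \<alpha> i) \<and> a = (\<Sum>i=0..b. \<beta> i) \<longrightarrow>
            of_nat (card {T \<in> labelled_bipartite_trees (a + 1) (b + 1).
                (\<forall>i\<in>{0..a}. graph_degree T (Inl i) = 1 + \<alpha> i) \<and>
                (\<forall>i\<in>{0..b}. graph_degree T (Inr i) = 1 + \<beta> i)})
              = multinomial a {0..b} \<beta> * multinomial b {0..a} \<alpha> \<and>
            multinomial a {0..b} \<beta> * multinomial b {0..a} \<alpha>
              = fact a * fact b / ((\<Prod>i=0..b. fact (\<beta> i)) * (\<Prod>i=0..a. fact (\<alpha> i))))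
       \<and> (\<Sum>T\<in>labelled_bipartite_trees (a + 1) (b + 1).
             (\<Prod>i=0..a. x_indet i ^ (graph_degree T (Inl i) - 1)) *
             (\<Prod>i=0..b. y_indet i ^ (graph_degree T (Inr i) - 1)))
           = (\<Sum>i=0..a. x_indet i) ^ b * (\<Sum>i=0..b. y_indet i) ^ a"
proof (intro conjI allI impI)
  let ?U = "Inl ` {0..a} :: (nat + nat) set" and ?V = "Inr ` {0..b} :: (nat + nat) set"
  have fin: "finite ?U" "finite ?V" and disj: "?U \<inter> ?V = {}" and ne: "?U \<noteq> {}" "?V \<noteq> {}"
    by auto
  have card: "card ?U = Suc a" "card ?V = Suc b"
    by (simp_all add: card_image)
  have trees: "labelled_bipartite_trees (a + 1) (b + 1) = bipartite_trees ?U ?V"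
    unfolding labelled_bipartite_trees_def by (simp add: lessThan_Suc_atMost atLeast0AtMost)
  show "(\<Sum>T\<in>labelled_bipartite_trees (a + 1) (b + 1).
      (\<Prod>i=0..a. x_indet i ^ (graph_degree T (Inl i) - 1)) *
      (\<Prod>i=0..b. y_indet i ^ (graph_degree T (Inr i) - 1)))
    = (\<Sum>i=0..a. x_indet i) ^ b * (\<Sum>i=0..b. y_indet i) ^ a"
    unfolding trees using bipartite_tree_degree_enumerator[OF fin disj ne, of indet]
    by (simp add: card prod.reindex sum.reindex)
  fix \<alpha> \<beta> :: "nat \<Rightarrow> nat"
  assume "b = (\<Sum>i=0..a. \<alpha> i) \<and> a = (\<Sum>i=0..b. \<beta> i)"
  note sums = this[THEN conjunct1, symmetric] this[THEN conjunct2, symmetric]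
  show "multinomial a {0..b} \<beta> * multinomial b {0..a} \<alpha>
      = fact a * fact b / ((\<Prod>i=0..b. fact (\<beta> i)) * (\<Prod>i=0..a. fact (\<alpha> i)))"
    by (simp add: multinomial_def)
  let ?d = "case_sum \<alpha> \<beta>"
  have "{T \<in> labelled_bipartite_trees (a + 1) (b + 1).
      (\<forall>i\<in>{0..a}. graph_degree T (Inl i) = 1 + \<alpha> i) \<and>
      (\<forall>i\<in>{0..b}. graph_degree T (Inr i) = 1 + \<beta> i)} = trees_with_degrees ?U ?V ?d"
    unfolding trees trees_with_degrees_def by (simp add: ball_Un)
  moreover have "card (trees_with_degrees ?U ?V ?d) = multinom ?U ?d * multinom ?V ?d"
    using sums by (intro card_trees_with_degrees[OF fin disj ne]) (simp_all add: card sum.reindex)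
  moreover have "multinom ?U ?d = multinom {0..a} \<alpha>" "multinom ?V ?d = multinom {0..b} \<beta>"
    by (simp_all add: multinom_def sum.reindex prod.reindex)
  ultimately show "of_nat (card {T \<in> labelled_bipartite_trees (a + 1) (b + 1).
      (\<forall>i\<in>{0..a}. graph_degree T (Inl i) = 1 + \<alpha> i) \<and>
      (\<forall>i\<in>{0..b}. graph_degree T (Inr i) = 1 + \<beta> i)})
    = multinomial a {0..b} \<beta> * multinomial b {0..a} \<alpha>"
    by (simp add: sums of_nat_multinom mult.commute)
qed

end
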